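(* Let $\{x_m\}_{m\ge 0}$ be an arbitrary sequence of vectors in $\mathbb{C}^N$, and let $k$ be an integer with $1\le k<k_0$. Let $s_k^{\mathrm{MPE}}$, $s_k^{\mathrm{RRE}}$ and $\gamma_k^{\mathrm{RRE}}$ be the objects produced by MPE and RRE (defined with respect to the fixed weighted inner product) from $\{x_m\}$. 1. If $s_k^{\mathrm{MPE}}$ does not exist, then $$s_k^{\mathrm{RRE}}=s_{k-1}^{\mathrm{RRE}},$$ which also implies $$U_k\gamma_k^{\mathrm{RRE}}=U_{k-1}\gamma_{k-1}^{\mathrm{RRE}}.$$ 2. Conversely, if $s_k^{\mathrm{RRE}}=s_{k-1}^{\mathrm{RRE}}$, then $s_k^{\mathrm{MPE}}$ does not exist.
   Context: Fix a hermitian positive definite matrix $M\in\mathbb{C}^{N\times N}$ and let $\langle y,z\rangle=y^*Mz$ and $[\![z]\!]=\sqrt{z^*Mz}$ for $y,z\in\mathbb{C}^N$. Given a sequence $\{x_m\}_{m\ge0}$ in $\mathbb{C}^N$, set $u_i=x_{i+1}-x_i$ and $U_k=[u_0\,|\,u_1\,|\cdots|\,u_k]\in\mathbb{C}^{N\times(k+1)}$. Let $k_0\le N$ be the integer such that $\operatorname{rank}(U_k)=k+1$ for $k=0,1,\dots,k_0-1$ and $\operatorname{rank}(U_{k_0})=k_0$; that is, $\{u_0,\dots,u_{k_0-1}\}$ is linearly independent but $\{u_0,\dots,u_{k_0}\}$ is not. Both methods produce vectors of the form $s_k=\sum_{i=0}^k\gamma_i x_i$ with $\sum_{i=0}^k\gamma_i=1$;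 write $\gamma_k=[\gamma_{k0},\dots,\gamma_{kk}]^T\in\mathbb{C}^{k+1}$ for the vector of coefficients belonging to $s_k$ (superscript MPE or RRE indicates the method). MPE (Minimal Polynomial Extrapolation), for $k<k_0$: let $c'=[c_0,\dots,c_{k-1}]^T\in\mathbb{C}^k$ be the unique minimizer of $[\![U_{k-1}c'+u_k]\!]$, and set $c_k=1$. If $\sum_{i=0}^k c_i\neq0$, then $\gamma_i=c_i/\sum_{j=0}^k c_j$, $i=0,\dots,k$, and $s_k^{\mathrm{MPE}}=\sum_{i=0}^k\gamma_ix_i$. We say that $s_k^{\mathrm{MPE}}$ exists if and only if $\sum_{i=0}^k c_i\neq0$. (For $k=0$ there is no minimization, $c_0=1$, and $s_0^{\mathrm{MPE}}=x_0$.) RRE (Reduced Rank Extrapolation), for $k<k_0$: $\gamma_k^{\mathrm{RRE}}$ is the unique minimizer of $[\![U_k\gamma]\!]$ over all $\gamma\in\mathbb{C}^{k+1}$ with $\sum_{i=0}^k\gamma_i=1$, and $s_k^{\mathrm{RRE}}=\sum_{i=0}^k\gamma_{ki}^{\mathrm{RRE}}x_i$ (this always exists). *)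

theory Defs
  imports
    "Jordan_Normal_Form.DL_Rank"
    "Jordan_Normal_Form.Schur_Decomposition"
begin

definition hermitian_pos_def :: "nat \<Rightarrow> complex mat \<Rightarrow> bool" where
  "hermitian_pos_def N M \<longleftrightarrow>
     M \<in> carrier_mat N N \<and> mat_adjoint M = M \<and>
     (\<forall>z \<in> carrier_vec N. z \<noteq> 0\<^sub>v N \<longrightarrow> 0 < Re (conjugate z \<bullet> (M *\<^sub>v z)))"

definition weighted_inner :: "complex mat \<Rightarrow> complex vec \<Rightarrow> complex vec \<Rightarrow> complex" where
  "weighted_inner M y z = conjugate y \<bullet> (M *\<^sub>v z)"

text \<open>For hermitian \<open>M\<close> the number \<open>weighted_inner M z z\<close> is real,
  so taking the real part loses nothing.\<close>

definition weighted_norm :: "complex mat \<Rightarrow> complex vec \<Rightarrow> real" where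
  "weighted_norm M z = sqrt (Re (weighted_inner M z z))"

definition diff_vec :: "(nat \<Rightarrow> complex vec) \<Rightarrow> nat \<Rightarrow> complex vec" where
  "diff_vec x i = x (i + 1) - x i"

text \<open>The \<open>N \<times> (k + 1)\<close> matrix with columns \<open>u\<^sub>0, \<dots>, u\<^sub>k\<close>.\<close>

definition diff_mat :: "nat \<Rightarrow> (nat \<Rightarrow> complex vec) \<Rightarrow> nat \<Rightarrow> complex mat" where
  "diff_mat N x k = mat_of_cols N (map (diff_vec x) [0..<k + 1])"

definition rank_index :: "nat \<Rightarrow> (nat \<Rightarrow> complex vec) \<Rightarrow> nat \<Rightarrow> bool" where
  "rank_index N x k0 \<longleftrightarrow>
     k0 \<le> N \<and>
     (\<forall>k < k0. vec_space.rank N (diff_mat N x k) = k + 1) \<and>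
     vec_space.rank N (diff_mat N x k0) = k0"

definition extrapolate :: "nat \<Rightarrow> (nat \<Rightarrow> complex vec) \<Rightarrow> nat \<Rightarrow> complex vec \<Rightarrow> complex vec" where
  "extrapolate N x k \<gamma> = finsum_vec TYPE(complex) N (\<lambda>i. \<gamma> $ i \<cdot>\<^sub>v x i) {0..k}"

text \<open>The definite descriptions below (for \<open>c'\<close> and for the RRE coefficients) denote the unique
  minimizers, which exist for \<open>k < k0\<close> because the columns of \<open>diff_mat N x k\<close> are then linearly
  independent; beyond that range they carry no meaning.\<close>

definition MPE_c' :: "nat \<Rightarrow> complex mat \<Rightarrow> (nat \<Rightarrow> complex vec) \<Rightarrow> nat \<Rightarrow> complex vec" where
  "MPE_c' N M x k =
     (if k = 0 then vNil
      else THE c'. is_arg_min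
             (\<lambda>c'. weighted_norm M (diff_mat N x (k - 1) *\<^sub>v c' + diff_vec x k))
             (\<lambda>c'. c' \<in> carrier_vec k) c')"

definition MPE_c :: "nat \<Rightarrow> complex mat \<Rightarrow> (nat \<Rightarrow> complex vec) \<Rightarrow> nat \<Rightarrow> complex vec" where
  "MPE_c N M x k = vec (k + 1) (\<lambda>i. if i < k then MPE_c' N M x k $ i else 1)"

definition MPE_gamma :: "nat \<Rightarrow> complex mat \<Rightarrow> (nat \<Rightarrow> complex vec) \<Rightarrow> nat \<Rightarrow> complex vec" where
  "MPE_gamma N M x k =
     vec (k + 1) (\<lambda>i. MPE_c N M x k $ i / (\<Sum>j = 0..k. MPE_c N M x k $ j))"

text \<open>The value is \<open>None\<close> exactly when the MPE vector does not exist.\<close>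

definition s_MPE :: "nat \<Rightarrow> complex mat \<Rightarrow> (nat \<Rightarrow> complex vec) \<Rightarrow> nat \<Rightarrow> complex vec option" where
  "s_MPE N M x k =
     (if (\<Sum>i = 0..k. MPE_c N M x k $ i) \<noteq> 0
      then Some (extrapolate N x k (MPE_gamma N M x k)) else None)"

definition RRE_gamma :: "nat \<Rightarrow> complex mat \<Rightarrow> (nat \<Rightarrow> complex vec) \<Rightarrow> nat \<Rightarrow> complex vec" where
  "RRE_gamma N M x k =
     (THE \<gamma>. is_arg_min
        (\<lambda>\<gamma>. weighted_norm M (diff_mat N x k *\<^sub>v \<gamma>))
        (\<lambda>\<gamma>. \<gamma> \<in> carrier_vec (k + 1) \<and> (\<Sum>i = 0..k. \<gamma> $ i) = 1) \<gamma>)"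

definition s_RRE :: "nat \<Rightarrow> complex mat \<Rightarrow> (nat \<Rightarrow> complex vec) \<Rightarrow> nat \<Rightarrow> complex vec" where
  "s_RRE N M x k = extrapolate N x k (RRE_gamma N M x k)"

end

theory Submission
  imports Defs
begin

text \<open>
  Both methods solve the same kind of problem. Let \<open>U = diff_mat N x k\<close>, which has full column rank
  because \<open>k < k\<^sub>0\<close>, so that the Gram matrix \<open>G = U\<^sup>* M U\<close> is positive definite. Minimising the
  weighted norm of \<open>U g\<close> subject to one affine constraint \<open>a\<^sup>* g = 1\<close> has a unique solution, namely
  the multiple of \<open>inverse(G) a\<close> that meets the constraint, and this solution satisfies \<open>G g = \<mu> a\<close> with
  \<open>\<mu> > 0\<close> (\<open>constrained_least_squares\<close>). The RRE coefficients \<open>\<gamma>\<close> are the case \<open>a = (1, \<dots>, 1)\<close>; the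
  unnormalised MPE coefficients \<open>c\<close>, whose last entry is 1, are the case in which \<open>a\<close> is the last
  unit vector.

  Since \<open>G\<close> is hermitian, the number \<open>\<gamma>\<^sup>* G c\<close> can be evaluated from either side. With multipliers
  \<open>\<tau>, \<mu> > 0\<close> for RRE and MPE this gives
  \<open>\<tau> (c\<^sub>0 + \<dots> + c\<^sub>k) = \<mu> cnj \<gamma>\<^sub>k\<close>, where \<open>\<gamma>\<^sub>k\<close> is the last entry of \<open>\<gamma>\<close>. Hence MPE breaks down
  exactly when this last entry vanishes (\<open>MPE_sum_zero_iff\<close>).

  It remains to see that \<open>\<gamma>\<^sub>k = 0\<close> is the same as stagnation of RRE. If \<open>\<gamma>\<^sub>k = 0\<close>, then \<open>\<gamma>\<close> without
  its last entry solves the RRE problem of order \<open>k - 1\<close>, and by uniqueness \<open>\<gamma>\<close> is the previous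
  coefficient vector extended by a zero (\<open>RRE_gamma_eq_snoc_if_last_zero\<close>); so neither the extrapolated
  vector nor the residual changes. Conversely, an affine combination of \<open>x\<^sub>0, \<dots>, x\<^sub>k\<close> determines its
  coefficients, since summation by parts rewrites the difference of two such combinations in terms of the
  linearly independent vectors \<open>u\<^sub>0, \<dots>, u\<^sub>k\<^sub>-\<^sub>1\<close> (\<open>extrapolate_eq_imp_last_zero\<close>).
\<close>

section \<open>Rank and reparametrised minimisation\<close>

lemma full_column_rank_inj:
  fixes A :: "complex mat"
  assumes A: "A \<in> carrier_mat n m" and rank: "vec_space.rank n A = m"
    and v: "v \<in> carrier_vec m" "A *\<^sub>v v = 0\<^sub>v n"
  shows "v = 0\<^sub>v m"
proof -
  interpret vec_space "TYPE(complex)" n .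
  \<comment> \<open>Linear independence is a property of the set of columns, which forgets repetitions; these are
    excluded because they would push the rank below the number of columns.\<close>
  have dist: "distinct (cols A)"
  proof (rule card_distinct)
    obtain S where S: "maximal S (\<lambda>T. T \<subseteq> set (cols A) \<and> lin_indpt T)"
      using maximal_exists[of "\<lambda>T. T \<subseteq> set (cols A) \<and> lin_indpt T" "card (set (cols A))" "{}"]
      by (meson List.finite_set card_mono empty_iff empty_subsetI finite_lin_indpt2 rev_finite_subset)
    then have "m = card S" "S \<subseteq> set (cols A)"
      using rank_card_indpt[OF A S] rank by (auto simp: maximal_def)
    then have "m \<le> card (set (cols A))" by (simp add: card_mono)
    then show "card (set (cols A)) = length (cols A)"
      using A card_length[of "cols A"] by simp
  qed
  show ?thesis
    using lin_depI[OF A v(1) _ v(2) dist] full_rank_lin_indpt[OF A rank dist] by blast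
qed

text \<open>Minimisers may be computed after a reparametrisation \<open>h\<close> of the feasible set. This carries the
  MPE problem, which is unconstrained in the first \<open>k\<close> coefficients, to one on all \<open>k + 1\<close> coefficients
  with the last of them prescribed.\<close>

lemma is_arg_min_bij:
  assumes into: "\<And>c. P c \<Longrightarrow> Q (h c)" and onto: "\<And>y. Q y \<Longrightarrow> \<exists>c. P c \<and> h c = y"
    and eq: "\<And>c. P c \<Longrightarrow> f c = g (h c)"
  shows "is_arg_min f P c \<longleftrightarrow> P c \<and> is_arg_min g Q (h c)"
proof -
  have "(\<exists>y. Q y \<and> g y < g (h c)) \<longleftrightarrow> (\<exists>y. P y \<and> f y < f c)" if c: "P c"
  proof
    assume "\<exists>y. Q y \<and> g y < g (h c)"
    then obtain y where y: "Q y" "g y < g (h c)" by blast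
    obtain b where "P b" "h b = y" using onto[OF y(1)] by blast
    then show "\<exists>y. P y \<and> f y < f c" using y(2) eq c by auto
  next
    assume "\<exists>y. P y \<and> f y < f c"
    then show "\<exists>y. Q y \<and> g y < g (h c)" using into eq c by metis
  qed
  then show ?thesis using into unfolding is_arg_min_def by blast
qed

section \<open>The weighted inner product\<close>

lemma adjoint_shift:
  fixes A :: "complex mat"
  assumes A: "A \<in> carrier_mat n m" and y: "y \<in> carrier_vec m" and z: "z \<in> carrier_vec n"
  shows "conjugate y \<bullet> (mat_adjoint A *\<^sub>v z) = conjugate (A *\<^sub>v y) \<bullet> z"
proof -
  have adj: "mat_adjoint A = (map_mat cnj A)\<^sup>T"
    using A by (intro eq_matI) (auto simp: mat_adjoint_def mat_of_rows_index conjugate_complex_def)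
  have conj: "conjugate (A *\<^sub>v y) = map_mat cnj A *\<^sub>v conjugate y"
    using A y by (intro eq_vecI) (auto simp: scalar_prod_def conjugate_complex_def)
  have B: "map_mat cnj A \<in> carrier_mat n m" using A by simp
  have cy: "conjugate y \<in> carrier_vec m" using y by simp
  have "conjugate y \<bullet> (mat_adjoint A *\<^sub>v z) = (mat_adjoint A *\<^sub>v z) \<bullet> conjugate y"
    by (rule comm_scalar_prod[of _ m]) (use A y z adj in auto)
  also have "\<dots> = z \<bullet> conjugate (A *\<^sub>v y)"
    unfolding adj conj by (rule transpose_vec_mult_scalar[OF B cy z])
  also have "\<dots> = conjugate (A *\<^sub>v y) \<bullet> z"
    by (rule comm_scalar_prod[of _ n]) (use A y z in auto)
  finally show ?thesis .
qed

lemma conjugate_sprod_swap: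
  fixes y z :: "complex vec"
  assumes "y \<in> carrier_vec n" "z \<in> carrier_vec n"
  shows "conjugate y \<bullet> z = cnj (conjugate z \<bullet> y)"
  using assms by (simp add: scalar_prod_def conjugate_complex_def mult.commute)

locale weighted_space =
  fixes N :: nat and M :: "complex mat"
  assumes hpd: "hermitian_pos_def N M"
begin

lemma M_carrier: "M \<in> carrier_mat N N"
  using hpd by (simp add: hermitian_pos_def_def)

lemma weighted_inner_swap:
  assumes y: "y \<in> carrier_vec N" and z: "z \<in> carrier_vec N"
  shows "weighted_inner M y z = cnj (weighted_inner M z y)"
proof -
  have herm: "mat_adjoint M = M" using hpd by (simp add: hermitian_pos_def_def)
  have "weighted_inner M y z = conjugate (M *\<^sub>v y) \<bullet> z"
    using adjoint_shift[OF M_carrier y z] by (simp add: weighted_inner_def herm)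
  also have "\<dots> = cnj (weighted_inner M z y)"
    unfolding weighted_inner_def
    by (rule conjugate_sprod_swap[of _ N]) (use M_carrier y z in auto)
  finally show ?thesis .
qed

lemma weighted_inner_add_right:
  assumes "w \<in> carrier_vec N" "y \<in> carrier_vec N" "z \<in> carrier_vec N"
  shows "weighted_inner M w (y + z) = weighted_inner M w y + weighted_inner M w z"
proof -
  have "M *\<^sub>v (y + z) = M *\<^sub>v y + M *\<^sub>v z"
    by (rule mult_add_distrib_mat_vec[OF M_carrier assms(2,3)])
  then show ?thesis
    unfolding weighted_inner_def
    using scalar_prod_add_distrib[of "conjugate w" N "M *\<^sub>v y" "M *\<^sub>v z"] assms M_carrier by simp
qed

lemma weighted_inner_smult_right:
  assumes "w \<in> carrier_vec N" "z \<in> carrier_vec N"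
  shows "weighted_inner M w (b \<cdot>\<^sub>v z) = b * weighted_inner M w z"
proof -
  have "M *\<^sub>v (b \<cdot>\<^sub>v z) = b \<cdot>\<^sub>v (M *\<^sub>v z)"
    by (rule mult_mat_vec[OF M_carrier assms(2)])
  then show ?thesis
    unfolding weighted_inner_def
    using scalar_prod_smult_distrib[of "conjugate w" N "M *\<^sub>v z" b] assms M_carrier by simp
qed

lemma weighted_inner_pos:
  assumes "z \<in> carrier_vec N" "z \<noteq> 0\<^sub>v N"
  shows "0 < Re (weighted_inner M z z)"
  using hpd assms by (auto simp: hermitian_pos_def_def weighted_inner_def)

lemma weighted_inner_self_real:
  assumes "z \<in> carrier_vec N"
  shows "weighted_inner M z z = of_real (Re (weighted_inner M z z))"
proof -
  have "Im (weighted_inner M z z) = Im (cnj (weighted_inner M z z))"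
    by (rule arg_cong[OF weighted_inner_swap[OF assms assms]])
  also have "\<dots> = - Im (weighted_inner M z z)" by simp
  finally show ?thesis by (intro complex_eqI) simp_all
qed

lemma weighted_inner_pythagoras:
  assumes y: "y \<in> carrier_vec N" and z: "z \<in> carrier_vec N" and 0: "weighted_inner M z y = 0"
  shows "Re (weighted_inner M (y + z) (y + z)) =
    Re (weighted_inner M y y) + Re (weighted_inner M z z)"
proof -
  have yz: "y + z \<in> carrier_vec N" using y z by simp
  have "weighted_inner M y z = 0"
    using weighted_inner_swap[OF y z] 0 by simp
  then have "weighted_inner M y (y + z) = weighted_inner M y y"
    and "weighted_inner M z (y + z) = weighted_inner M z z"
    using weighted_inner_add_right[OF y y z] weighted_inner_add_right[OF z y z] 0 by simp_all
  moreover have "weighted_inner M (y + z) (y + z) =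
      cnj (weighted_inner M y (y + z)) + cnj (weighted_inner M z (y + z))"
    unfolding weighted_inner_add_right[OF yz y z]
    by (simp only: weighted_inner_swap[OF yz y] weighted_inner_swap[OF yz z])
  ultimately show ?thesis by simp
qed

section \<open>Least squares under one affine constraint\<close>

text \<open>The Gram matrix \<open>G\<close> of the columns of \<open>U\<close> is definite, hence invertible, and the minimiser is
  \<open>g = y / (a\<^sup>* y)\<close> with \<open>G y = a\<close>; here \<open>a\<^sup>* y = y\<^sup>* G y\<close> is positive. The stationarity
  condition \<open>G g = \<mu> a\<close> says that \<open>U g\<close> is orthogonal to \<open>U d\<close> for every direction \<open>d\<close> with
  \<open>a\<^sup>* d = 0\<close>, so optimality and uniqueness follow from Pythagoras. The condition is stated in weak
  form, tested against all \<open>z\<close>, to avoid mentioning \<open>G\<close>.\<close>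

lemma constrained_least_squares:
  assumes U: "U \<in> carrier_mat N n"
    and rank: "vec_space.rank N U = n"
    and a: "a \<in> carrier_vec n" "a \<noteq> 0\<^sub>v n"
  obtains g and \<mu> :: real where "g \<in> carrier_vec n" and "0 < \<mu>" and "conjugate a \<bullet> g = 1"
    and "\<And>z. z \<in> carrier_vec n \<Longrightarrow>
      weighted_inner M (U *\<^sub>v z) (U *\<^sub>v g) = of_real \<mu> * (conjugate z \<bullet> a)"
    and "\<And>z. is_arg_min (\<lambda>z. weighted_norm M (U *\<^sub>v z))
      (\<lambda>z. z \<in> carrier_vec n \<and> conjugate a \<bullet> z = 1) z \<longleftrightarrow> z = g"
proof -
  define G where "G = mat_adjoint U * (M * U)"
  have adjU: "mat_adjoint U \<in> carrier_mat n N"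
    using U by (auto simp: mat_adjoint_def)
  have G: "G \<in> carrier_mat n n"
    using adjU M_carrier U by (simp add: G_def)
  have Uc: "U *\<^sub>v z \<in> carrier_vec N" if "z \<in> carrier_vec n" for z
    using U that by simp
  have gram: "weighted_inner M (U *\<^sub>v z) (U *\<^sub>v y) = conjugate z \<bullet> (G *\<^sub>v y)"
    if "y \<in> carrier_vec n" "z \<in> carrier_vec n" for y z
  proof -
    have "G *\<^sub>v y = mat_adjoint U *\<^sub>v (M *\<^sub>v (U *\<^sub>v y))"
      unfolding G_def using adjU M_carrier U that
      by (simp add: assoc_mult_mat_vec[of _ n N _ n] assoc_mult_mat_vec[of _ N N _ n])
    then show ?thesis
      using adjoint_shift[OF U that(2), of "M *\<^sub>v (U *\<^sub>v y)"] M_carrier U that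
      by (simp add: weighted_inner_def)
  qed
  have pos: "0 < Re (weighted_inner M (U *\<^sub>v z) (U *\<^sub>v z))"
    if "z \<in> carrier_vec n" "z \<noteq> 0\<^sub>v n" for z
    using weighted_inner_pos[OF Uc[OF that(1)]] full_column_rank_inj[OF U rank that(1)] that(2) by blast
  have "det G \<noteq> 0"
  proof
    assume "det G = 0"
    then obtain v where v: "v \<in> carrier_vec n" "v \<noteq> 0\<^sub>v n" "G *\<^sub>v v = 0\<^sub>v n"
      using det_0_iff_vec_prod_zero_field[OF G] by auto
    show False using pos[OF v(1,2)] gram[OF v(1) v(1)] v by simp
  qed
  then obtain B where B: "B \<in> carrier_mat n n" "G * B = 1\<^sub>m n"
    using det_non_zero_imp_unit[OF G, of "()"] by (auto simp: Units_def ring_mat_def)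
  define y where "y = B *\<^sub>v a"
  have y: "y \<in> carrier_vec n" using B a by (simp add: y_def)
  have Gy: "G *\<^sub>v y = a"
    unfolding y_def using B a G by (simp add: assoc_mult_mat_vec[of _ n n _ n, symmetric])
  then have "y \<noteq> 0\<^sub>v n" using a G by auto
  define \<rho> where "\<rho> = Re (weighted_inner M (U *\<^sub>v y) (U *\<^sub>v y))"
  have \<rho>: "0 < \<rho>" using pos[OF y \<open>y \<noteq> 0\<^sub>v n\<close>] by (simp add: \<rho>_def)
  have "conjugate y \<bullet> a = of_real \<rho>"
    using gram[OF y y] weighted_inner_self_real[OF Uc[OF y]] unfolding \<rho>_def Gy by (rule trans[OF sym])
  then have ay: "conjugate a \<bullet> y = of_real \<rho>"
    using conjugate_sprod_swap[OF a(1) y] by simp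
  define g where "g = of_real (1 / \<rho>) \<cdot>\<^sub>v y"
  have g: "g \<in> carrier_vec n" using y by (simp add: g_def)
  have ag: "conjugate a \<bullet> g = 1"
    using a y ay \<rho> by (simp add: g_def scalar_prod_smult_distrib[of _ n])
  have normal: "weighted_inner M (U *\<^sub>v z) (U *\<^sub>v g) = of_real (1 / \<rho>) * (conjugate z \<bullet> a)"
    if z: "z \<in> carrier_vec n" for z
    using gram[OF y z] Gy U y z
    by (simp add: g_def mult_mat_vec[of _ N n] weighted_inner_smult_right)
  have better: "weighted_norm M (U *\<^sub>v g) < weighted_norm M (U *\<^sub>v z)"
    if z: "z \<in> carrier_vec n" "conjugate a \<bullet> z = 1" "z \<noteq> g" for z
  proof -
    define d where "d = z - g"
    have d: "d \<in> carrier_vec n" using z g by (simp add: d_def)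
    have zgd: "z = g + d" using z g by (auto simp: d_def)
    have d0: "d \<noteq> 0\<^sub>v n" using z(3) g zgd by auto
    have "conjugate a \<bullet> d = 0"
      using z(2) ag a g d zgd by (simp add: scalar_prod_add_distrib[of _ n])
    then have "conjugate d \<bullet> a = 0"
      using conjugate_sprod_swap[OF d a(1)] by simp
    then have "weighted_inner M (U *\<^sub>v d) (U *\<^sub>v g) = 0"
      using normal[OF d] by simp
    moreover have "U *\<^sub>v z = U *\<^sub>v g + U *\<^sub>v d"
      using U g d by (simp add: zgd mult_add_distrib_mat_vec[of _ N n])
    ultimately have "Re (weighted_inner M (U *\<^sub>v z) (U *\<^sub>v z)) =
        Re (weighted_inner M (U *\<^sub>v g) (U *\<^sub>v g)) + Re (weighted_inner M (U *\<^sub>v d) (U *\<^sub>v d))"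
      using weighted_inner_pythagoras[OF Uc[OF g] Uc[OF d]] by simp
    then show ?thesis
      using pos[OF d d0] by (simp add: weighted_norm_def)
  qed
  show ?thesis
  proof (rule that[OF g _ ag normal])
    show "0 < 1 / \<rho>" using \<rho> by simp
    show "is_arg_min (\<lambda>z. weighted_norm M (U *\<^sub>v z))
      (\<lambda>z. z \<in> carrier_vec n \<and> conjugate a \<bullet> z = 1) z \<longleftrightarrow> z = g" for z
    proof
      assume "is_arg_min (\<lambda>z. weighted_norm M (U *\<^sub>v z))
        (\<lambda>z. z \<in> carrier_vec n \<and> conjugate a \<bullet> z = 1) z"
      then have z: "z \<in> carrier_vec n" "conjugate a \<bullet> z = 1"
        and min: "\<not> weighted_norm M (U *\<^sub>v g) < weighted_norm M (U *\<^sub>v z)"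
        unfolding is_arg_min_def using g ag by blast+
      show "z = g" using better[OF z] min by blast
    next
      assume z: "z = g"
      show "is_arg_min (\<lambda>z. weighted_norm M (U *\<^sub>v z))
        (\<lambda>z. z \<in> carrier_vec n \<and> conjugate a \<bullet> z = 1) z"
        unfolding is_arg_min_def z
      proof (intro conjI notI g ag)
        assume "\<exists>y. (y \<in> carrier_vec n \<and> conjugate a \<bullet> y = 1) \<and>
          weighted_norm M (U *\<^sub>v y) < weighted_norm M (U *\<^sub>v g)"
        then obtain y where y: "y \<in> carrier_vec n" "conjugate a \<bullet> y = 1"
          and less: "weighted_norm M (U *\<^sub>v y) < weighted_norm M (U *\<^sub>v g)" by blast
        show False
        proof (cases "y = g")
          case True
          then show False using less by simp
        next
          case False
          show False using less_asym[OF less better[OF y False]] .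
        qed
      qed
    qed
  qed
qed

end

section \<open>Difference matrices and extrapolation\<close>

definition snoc_vec :: "complex vec \<Rightarrow> complex \<Rightarrow> complex vec" where
  "snoc_vec v b = vec (dim_vec v + 1) (\<lambda>i. if i < dim_vec v then v $ i else b)"

lemma snoc_vec_carrier: "v \<in> carrier_vec k \<Longrightarrow> snoc_vec v b \<in> carrier_vec (k + 1)"
  by (auto simp: snoc_vec_def)

lemma snoc_vec_index:
  "i < dim_vec v \<Longrightarrow> snoc_vec v b $ i = v $ i" "snoc_vec v b $ dim_vec v = b"
  by (auto simp: snoc_vec_def)

lemma snoc_vec_inject:
  assumes v: "v \<in> carrier_vec k" and w: "w \<in> carrier_vec k"
  shows "snoc_vec v b = snoc_vec w b \<longleftrightarrow> v = w"
proof
  assume eq: "snoc_vec v b = snoc_vec w b"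
  show "v = w"
  proof (rule eq_vecI)
    show "dim_vec v = dim_vec w" using v w by simp
    fix i assume "i < dim_vec w"
    then show "v $ i = w $ i"
      using snoc_vec_index(1)[of i v b] snoc_vec_index(1)[of i w b] eq v w by simp
  qed
qed simp

lemma snoc_vec_surj:
  assumes "v \<in> carrier_vec (k + 1)"
  obtains w where "w \<in> carrier_vec k" "v = snoc_vec w (v $ k)"
proof
  show "vec k (($) v) \<in> carrier_vec k" by simp
  show "v = snoc_vec (vec k (($) v)) (v $ k)"
  proof (rule eq_vecI)
    show "dim_vec v = dim_vec (snoc_vec (vec k (($) v)) (v $ k))"
      using assms by (simp add: snoc_vec_def)
    fix i assume "i < dim_vec (snoc_vec (vec k (($) v)) (v $ k))"
    then have "i < k \<or> i = k" by (auto simp: snoc_vec_def)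
    then show "v $ i = snoc_vec (vec k (($) v)) (v $ k) $ i"
      by (auto simp: snoc_vec_def)
  qed
qed

lemma sum_snoc_vec:
  assumes "v \<in> carrier_vec k" "1 \<le> k"
  shows "(\<Sum>i = 0..k. snoc_vec v b $ i) = (\<Sum>i = 0..k - 1. v $ i) + b"
proof -
  have dim: "dim_vec v = k" using assms(1) by simp
  obtain j where k: "k = Suc j" using assms(2) by (cases k) auto
  have "(\<Sum>i = 0..j. snoc_vec v b $ i) = (\<Sum>i = 0..j. v $ i)"
    by (rule sum.cong) (auto simp: snoc_vec_index(1) dim k)
  moreover have "snoc_vec v b $ k = b" using snoc_vec_index(2)[of v b] dim by simp
  ultimately show ?thesis by (simp add: k)
qed

text \<open>When the weights \<open>d i\<close> add up to zero, only increments of \<open>y\<close> remain on the right-hand side.\<close>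

lemma summation_by_parts:
  fixes d y :: "nat \<Rightarrow> complex"
  shows "(\<Sum>i = 0..k. d i * y i) =
    (\<Sum>i = 0..k. d i) * y k - (\<Sum>j<k. (\<Sum>i = 0..j. d i) * (y (j + 1) - y j))"
  by (induction k) (auto simp: algebra_simps)

locale vector_sequence = weighted_space +
  fixes x :: "nat \<Rightarrow> complex vec"
  assumes x: "x m \<in> carrier_vec N"
begin

lemma diff_vec_carrier: "diff_vec x k \<in> carrier_vec N"
  unfolding diff_vec_def by (rule minus_carrier_vec[OF x x])

lemma diff_mat_carrier: "diff_mat N x k \<in> carrier_mat N (k + 1)"
  unfolding diff_mat_def using mat_of_cols_carrier(1)[of N "map (diff_vec x) [0..<k + 1]"] by simp

lemma diff_mat_mult_index:
  assumes "v \<in> carrier_vec (k + 1)" "r < N"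
  shows "(diff_mat N x k *\<^sub>v v) $ r = (\<Sum>i = 0..k. v $ i * (x (i + 1) $ r - x i $ r))"
proof -
  have entry: "diff_mat N x k $$ (r, i) = x (i + 1) $ r - x i $ r" if i: "i < k + 1" for i
  proof -
    have "diff_mat N x k $$ (r, i) = map (diff_vec x) [0..<k + 1] ! i $ r"
      unfolding diff_mat_def by (rule mat_of_cols_index) (use i assms(2) in simp_all)
    also have "map (diff_vec x) [0..<k + 1] ! i = diff_vec x i"
      using i by (simp del: upt_Suc)
    also have "diff_vec x i $ r = x (i + 1) $ r - x i $ r"
      unfolding diff_vec_def by (rule index_minus_vec(1)) (use assms(2) carrier_vecD[OF x] in metis)
    finally show ?thesis .
  qed
  have "(diff_mat N x k *\<^sub>v v) $ r = (\<Sum>i = 0..<k + 1. diff_mat N x k $$ (r, i) * v $ i)"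
    using assms diff_mat_carrier[of k] by (simp add: scalar_prod_def)
  also have "\<dots> = (\<Sum>i = 0..k. v $ i * (x (i + 1) $ r - x i $ r))"
    by (rule sum.cong) (auto simp: entry)
  finally show ?thesis .
qed

lemma diff_mat_snoc:
  assumes "v \<in> carrier_vec k" "1 \<le> k"
  shows "diff_mat N x k *\<^sub>v snoc_vec v b = diff_mat N x (k - 1) *\<^sub>v v + b \<cdot>\<^sub>v diff_vec x k"
proof (rule eq_vecI)
  have dx: "diff_vec x k \<in> carrier_vec N" by (rule diff_vec_carrier)
  show "dim_vec (diff_mat N x k *\<^sub>v snoc_vec v b) =
      dim_vec (diff_mat N x (k - 1) *\<^sub>v v + b \<cdot>\<^sub>v diff_vec x k)"
    using dx diff_mat_carrier[of k] by simp
  fix r assume "r < dim_vec (diff_mat N x (k - 1) *\<^sub>v v + b \<cdot>\<^sub>v diff_vec x k)"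
  then have r: "r < N" using dx by simp
  obtain j where k: "k = Suc j" using assms(2) by (cases k) auto
  show "(diff_mat N x k *\<^sub>v snoc_vec v b) $ r =
      (diff_mat N x (k - 1) *\<^sub>v v + b \<cdot>\<^sub>v diff_vec x k) $ r"
    using diff_mat_mult_index[OF snoc_vec_carrier[OF assms(1)] r, of b]
      diff_mat_mult_index[of v j r] assms(1) r dx x[of k] x[of "k + 1"] diff_mat_carrier[of j]
    by (auto simp: k snoc_vec_def diff_vec_def)
qed

lemma diff_mat_snoc_zero:
  assumes v: "v \<in> carrier_vec k" and k: "1 \<le> k"
  shows "diff_mat N x k *\<^sub>v snoc_vec v 0 = diff_mat N x (k - 1) *\<^sub>v v"
proof -
  have "diff_vec x k \<in> carrier_vec N" "diff_mat N x (k - 1) *\<^sub>v v \<in> carrier_vec N"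
    using diff_vec_carrier diff_mat_carrier[of "k - 1"] v k by simp_all
  moreover have "0 \<cdot>\<^sub>v diff_vec x k = 0\<^sub>v N"
    using carrier_vecD[OF diff_vec_carrier[of k]] by (intro eq_vecI) auto
  ultimately show ?thesis using diff_mat_snoc[OF v k, of 0] by simp
qed

lemma extrapolate_index:
  assumes "r < N"
  shows "extrapolate N x k v $ r = (\<Sum>i = 0..k. v $ i * x i $ r)"
proof -
  have "extrapolate N x k v $ r = (\<Sum>i = 0..k. (v $ i \<cdot>\<^sub>v x i) $ r)"
    unfolding extrapolate_def
    by (rule index_finsum_vec) (use assms in \<open>simp_all add: Pi_def smult_carrier_vec x\<close>)
  also have "\<dots> = (\<Sum>i = 0..k. v $ i * x i $ r)"
    by (rule sum.cong[OF refl], rule index_smult_vec(1)) (use assms carrier_vecD[OF x] in metis)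
  finally show ?thesis .
qed

lemma extrapolate_dim: "dim_vec (extrapolate N x k v) = N"
proof -
  interpret vec_space "TYPE(complex)" N .
  show ?thesis
    unfolding extrapolate_def finsum_vec
    by (rule finsum_dim) (simp_all add: Pi_def smult_carrier_vec x)
qed

lemma extrapolate_snoc_zero:
  assumes v: "v \<in> carrier_vec k" and k: "1 \<le> k"
  shows "extrapolate N x k (snoc_vec v 0) = extrapolate N x (k - 1) v"
proof (rule eq_vecI)
  fix r assume "r < dim_vec (extrapolate N x (k - 1) v)"
  then have r: "r < N" by (simp only: extrapolate_dim)
  obtain j where j: "k = Suc j" using k by (cases k) auto
  have "(\<Sum>i = 0..j. snoc_vec v 0 $ i * x i $ r) = (\<Sum>i = 0..j. v $ i * x i $ r)"
    by (rule sum.cong) (use v in \<open>auto simp: snoc_vec_index(1) j\<close>)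
  moreover have "snoc_vec v 0 $ k = 0" using snoc_vec_index(2)[of v 0] v by simp
  ultimately show "extrapolate N x k (snoc_vec v 0) $ r = extrapolate N x (k - 1) v $ r"
    using r by (simp add: extrapolate_index j)
qed (simp only: extrapolate_dim)

text \<open>The coefficient vectors \<open>v\<close> and \<open>w\<close> (extended by 0) differ by some \<open>d\<close> with sum zero. By summation
  by parts the partial sums of \<open>d\<close> are the coefficients of a vanishing combination of
  \<open>u\<^sub>0, \<dots>, u\<^sub>k\<^sub>-\<^sub>1\<close>, so they vanish, and with them \<open>d k = v $ k\<close>.\<close>

lemma extrapolate_eq_imp_last_zero:
  assumes k: "1 \<le> k"
    and rank': "vec_space.rank N (diff_mat N x (k - 1)) = k"
    and v: "v \<in> carrier_vec (k + 1)" "(\<Sum>i = 0..k. v $ i) = 1"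
    and w: "w \<in> carrier_vec k" "(\<Sum>i = 0..k - 1. w $ i) = 1"
    and eq: "extrapolate N x k v = extrapolate N x (k - 1) w"
  shows "v $ k = 0"
proof -
  have Suc: "k - 1 + 1 = k" using k by simp
  define d where "d i = v $ i - snoc_vec w 0 $ i" for i
  have sum_d: "(\<Sum>i = 0..k. d i) = 0"
    using v(2) w(2) sum_snoc_vec[OF w(1) k, of 0] by (simp add: d_def sum_subtractf)
  define p where "p = vec k (\<lambda>j. \<Sum>i = 0..j. d i)"
  have p: "p \<in> carrier_vec k" by (simp add: p_def)
  have "diff_mat N x (k - 1) *\<^sub>v p = 0\<^sub>v N"
  proof (rule eq_vecI)
    show "dim_vec (diff_mat N x (k - 1) *\<^sub>v p) = dim_vec (0\<^sub>v N :: complex vec)"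
      using diff_mat_carrier[of "k - 1"] by simp
    fix r assume "r < dim_vec (0\<^sub>v N :: complex vec)"
    then have r: "r < N" by simp
    have "extrapolate N x k v $ r = extrapolate N x k (snoc_vec w 0) $ r"
      using eq extrapolate_snoc_zero[OF w(1) k] by simp
    then have "(\<Sum>i = 0..k. d i * x i $ r) = 0"
      using r by (simp add: extrapolate_index d_def left_diff_distrib sum_subtractf)
    then have "(\<Sum>j<k. (\<Sum>i = 0..j. d i) * (x (j + 1) $ r - x j $ r)) = 0"
      using summation_by_parts[of d "\<lambda>i. x i $ r" k] sum_d by simp
    moreover have "(diff_mat N x (k - 1) *\<^sub>v p) $ r =
        (\<Sum>j<k. (\<Sum>i = 0..j. d i) * (x (j + 1) $ r - x j $ r))"
      using diff_mat_mult_index[of p "k - 1" r] p r k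
      by (auto simp: p_def intro!: sum.cong)
    ultimately show "(diff_mat N x (k - 1) *\<^sub>v p) $ r = 0\<^sub>v N $ r" using r by simp
  qed
  then have "p = 0\<^sub>v k" by (rule full_column_rank_inj[OF diff_mat_carrier[of "k - 1", unfolded Suc] rank' p])
  then have "p $ (k - 1) = 0" using k by simp
  then have "(\<Sum>i = 0..k - 1. d i) = 0" using k by (simp add: p_def)
  then have "d k = 0" using sum_d k by (cases k) auto
  then show ?thesis
    using snoc_vec_index(2)[of w 0] carrier_vecD[OF w(1)] by (simp add: d_def)
qed

section \<open>Stagnation of RRE and breakdown of MPE\<close>

text \<open>The stationarity condition for RRE: the residual \<open>U \<gamma>\<close> has the same inner product \<open>\<mu>\<close> with all
  the differences \<open>u\<^sub>0, \<dots>, u\<^sub>k\<close>.\<close>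

lemma RRE_gamma_characterisation:
  assumes rank: "vec_space.rank N (diff_mat N x k) = k + 1"
  obtains \<mu> :: real where "RRE_gamma N M x k \<in> carrier_vec (k + 1)"
    and "(\<Sum>i = 0..k. RRE_gamma N M x k $ i) = 1" and "0 < \<mu>"
    and "\<And>z. z \<in> carrier_vec (k + 1) \<Longrightarrow>
      weighted_inner M (diff_mat N x k *\<^sub>v z) (diff_mat N x k *\<^sub>v RRE_gamma N M x k) =
        of_real \<mu> * cnj (\<Sum>i = 0..k. z $ i)"
    and "\<And>z. is_arg_min (\<lambda>z. weighted_norm M (diff_mat N x k *\<^sub>v z))
      (\<lambda>z. z \<in> carrier_vec (k + 1) \<and> (\<Sum>i = 0..k. z $ i) = 1) z \<longleftrightarrow> z = RRE_gamma N M x k"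
proof -
  define e :: "complex vec" where "e = vec (k + 1) (\<lambda>_. 1)"
  have e: "e \<in> carrier_vec (k + 1)" by (simp add: e_def)
  have e_nonzero: "e \<noteq> 0\<^sub>v (k + 1)"
  proof
    assume "e = 0\<^sub>v (k + 1)"
    then have "e $ 0 = 0" by simp
    then show False by (simp add: e_def)
  qed
  have e_left: "conjugate e \<bullet> z = (\<Sum>i = 0..k. z $ i)" if "z \<in> carrier_vec (k + 1)" for z
    unfolding scalar_prod_def by (rule sum.cong) (use that in \<open>auto simp: e_def conjugate_complex_def\<close>)
  have e_right: "conjugate z \<bullet> e = cnj (\<Sum>i = 0..k. z $ i)" if "z \<in> carrier_vec (k + 1)" for z
    using conjugate_sprod_swap[OF that e] e_left[OF that] by simp
  have feasible: "(\<lambda>z. z \<in> carrier_vec (k + 1) \<and> conjugate e \<bullet> z = 1) =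
      (\<lambda>z. z \<in> carrier_vec (k + 1) \<and> (\<Sum>i = 0..k. z $ i) = 1)"
    using e_left by auto
  obtain g \<mu> where g: "g \<in> carrier_vec (k + 1)" and \<mu>: "0 < \<mu>" and eg: "conjugate e \<bullet> g = 1"
    and normal: "\<And>z. z \<in> carrier_vec (k + 1) \<Longrightarrow>
      weighted_inner M (diff_mat N x k *\<^sub>v z) (diff_mat N x k *\<^sub>v g) = of_real \<mu> * (conjugate z \<bullet> e)"
    and amin: "\<And>z. is_arg_min (\<lambda>z. weighted_norm M (diff_mat N x k *\<^sub>v z))
      (\<lambda>z. z \<in> carrier_vec (k + 1) \<and> conjugate e \<bullet> z = 1) z \<longleftrightarrow> z = g"
    using constrained_least_squares[OF diff_mat_carrier rank e e_nonzero] by blast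
  have \<gamma>: "RRE_gamma N M x k = g"
    unfolding RRE_gamma_def
    by (rule the_equality) (use amin[unfolded feasible] in blast)+
  show thesis
  proof (rule that[unfolded \<gamma>])
    show "(\<Sum>i = 0..k. g $ i) = 1" using eg e_left[OF g] by simp
    show "weighted_inner M (diff_mat N x k *\<^sub>v z) (diff_mat N x k *\<^sub>v g) =
        of_real \<mu> * cnj (\<Sum>i = 0..k. z $ i)" if "z \<in> carrier_vec (k + 1)" for z
      using normal[OF that] e_right[OF that] by simp
    show "g \<in> carrier_vec (k + 1)" "0 < \<mu>" by (fact g, fact \<mu>)
    show "is_arg_min (\<lambda>z. weighted_norm M (diff_mat N x k *\<^sub>v z))
      (\<lambda>z. z \<in> carrier_vec (k + 1) \<and> (\<Sum>i = 0..k. z $ i) = 1) z \<longleftrightarrow> z = g" for z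
      by (rule amin[unfolded feasible])
  qed
qed

text \<open>The stationarity condition for MPE: the residual \<open>U c\<close> is orthogonal to \<open>u\<^sub>0, \<dots>, u\<^sub>k\<^sub>-\<^sub>1\<close>. That its
  inner product \<open>\<mu>\<close> with \<open>u\<^sub>k\<close> is positive, and not merely nonnegative, is what makes the
  breakdown criterion below an equivalence.\<close>

lemma MPE_c_characterisation:
  assumes k: "1 \<le> k"
    and rank: "vec_space.rank N (diff_mat N x k) = k + 1"
  obtains \<mu> :: real where "MPE_c N M x k \<in> carrier_vec (k + 1)" and "0 < \<mu>"
    and "\<And>z. z \<in> carrier_vec (k + 1) \<Longrightarrow>
      weighted_inner M (diff_mat N x k *\<^sub>v z) (diff_mat N x k *\<^sub>v MPE_c N M x k) =
        of_real \<mu> * cnj (z $ k)"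
proof -
  define e :: "complex vec" where "e = unit_vec (k + 1) k"
  have e: "e \<in> carrier_vec (k + 1)" by (simp add: e_def)
  have e_nonzero: "e \<noteq> 0\<^sub>v (k + 1)"
  proof
    assume "e = 0\<^sub>v (k + 1)"
    then have "e $ k = 0" by simp
    then show False by (simp add: e_def)
  qed
  have e_right: "conjugate z \<bullet> e = cnj (z $ k)" if "z \<in> carrier_vec (k + 1)" for z
    using that scalar_prod_right_unit[of k "k + 1" "conjugate z"]
    by (simp add: e_def conjugate_complex_def)
  have e_left: "conjugate e \<bullet> z = z $ k" if "z \<in> carrier_vec (k + 1)" for z
    using conjugate_sprod_swap[OF e that] e_right[OF that] by simp
  obtain g \<mu> where g: "g \<in> carrier_vec (k + 1)" and \<mu>: "0 < \<mu>" and eg: "conjugate e \<bullet> g = 1"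
    and normal: "\<And>z. z \<in> carrier_vec (k + 1) \<Longrightarrow>
      weighted_inner M (diff_mat N x k *\<^sub>v z) (diff_mat N x k *\<^sub>v g) = of_real \<mu> * (conjugate z \<bullet> e)"
    and amin: "\<And>z. is_arg_min (\<lambda>z. weighted_norm M (diff_mat N x k *\<^sub>v z))
      (\<lambda>z. z \<in> carrier_vec (k + 1) \<and> conjugate e \<bullet> z = 1) z \<longleftrightarrow> z = g"
    using constrained_least_squares[OF diff_mat_carrier rank e e_nonzero] by blast
  obtain w where w: "w \<in> carrier_vec k" and gw: "g = snoc_vec w 1"
    using snoc_vec_surj[OF g] e_left[OF g] eg by metis
  have "is_arg_min (\<lambda>c. weighted_norm M (diff_mat N x (k - 1) *\<^sub>v c + diff_vec x k))
      (\<lambda>c. c \<in> carrier_vec k) c \<longleftrightarrow> c \<in> carrier_vec k \<and>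
      is_arg_min (\<lambda>z. weighted_norm M (diff_mat N x k *\<^sub>v z))
        (\<lambda>z. z \<in> carrier_vec (k + 1) \<and> conjugate e \<bullet> z = 1) (snoc_vec c 1)" for c
  proof (rule is_arg_min_bij)
    fix c :: "complex vec" assume c: "c \<in> carrier_vec k"
    show "snoc_vec c 1 \<in> carrier_vec (k + 1) \<and> conjugate e \<bullet> snoc_vec c 1 = 1"
      using snoc_vec_carrier[OF c] e_left snoc_vec_index(2)[of c 1] c by simp
    show "weighted_norm M (diff_mat N x (k - 1) *\<^sub>v c + diff_vec x k) =
        weighted_norm M (diff_mat N x k *\<^sub>v snoc_vec c 1)"
      using diff_mat_snoc[OF c k, of 1] by simp
  next
    fix y assume y: "y \<in> carrier_vec (k + 1) \<and> conjugate e \<bullet> y = 1"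
    then obtain c where "c \<in> carrier_vec k" "y = snoc_vec c (y $ k)"
      using snoc_vec_surj by blast
    then show "\<exists>c. c \<in> carrier_vec k \<and> snoc_vec c 1 = y"
      using y e_left by metis
  qed
  moreover have "snoc_vec c 1 = snoc_vec w 1 \<longleftrightarrow> c = w" if "c \<in> carrier_vec k" for c
    by (rule snoc_vec_inject[OF that w])
  ultimately have "is_arg_min (\<lambda>c. weighted_norm M (diff_mat N x (k - 1) *\<^sub>v c + diff_vec x k))
      (\<lambda>c. c \<in> carrier_vec k) c \<longleftrightarrow> c = w" for c
    using w unfolding amin gw by auto
  then have "(THE c. is_arg_min (\<lambda>c. weighted_norm M (diff_mat N x (k - 1) *\<^sub>v c + diff_vec x k))
      (\<lambda>c. c \<in> carrier_vec k) c) = w"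
    by (intro the_equality) blast+
  then have c': "MPE_c' N M x k = w"
    using k by (simp add: MPE_c'_def)
  have c: "MPE_c N M x k = g"
    unfolding MPE_c_def gw snoc_vec_def c' carrier_vecD[OF w] ..
  show thesis
  proof (rule that[unfolded c])
    show "weighted_inner M (diff_mat N x k *\<^sub>v z) (diff_mat N x k *\<^sub>v g) = of_real \<mu> * cnj (z $ k)"
      if "z \<in> carrier_vec (k + 1)" for z
      using normal[OF that] e_right[OF that] by simp
    show "g \<in> carrier_vec (k + 1)" "0 < \<mu>" by (fact g, fact \<mu>)
  qed
qed

text \<open>Testing the RRE condition against \<open>c\<close> and the MPE condition against \<open>\<gamma>\<close> evaluates the inner
  product of the two residuals in two ways.\<close>

lemma MPE_sum_zero_iff:
  assumes k: "1 \<le> k"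
    and rank: "vec_space.rank N (diff_mat N x k) = k + 1"
  shows "(\<Sum>i = 0..k. MPE_c N M x k $ i) = 0 \<longleftrightarrow> RRE_gamma N M x k $ k = 0"
proof -
  let ?U = "diff_mat N x k" and ?c = "MPE_c N M x k" and ?\<gamma> = "RRE_gamma N M x k"
  obtain \<tau> :: real where \<gamma>: "?\<gamma> \<in> carrier_vec (k + 1)" and \<tau>: "0 < \<tau>"
    and RRE: "\<And>z. z \<in> carrier_vec (k + 1) \<Longrightarrow>
      weighted_inner M (?U *\<^sub>v z) (?U *\<^sub>v ?\<gamma>) = of_real \<tau> * cnj (\<Sum>i = 0..k. z $ i)"
    using RRE_gamma_characterisation[OF rank] by blast
  obtain \<mu> :: real where c: "?c \<in> carrier_vec (k + 1)" and \<mu>: "0 < \<mu>"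
    and MPE: "\<And>z. z \<in> carrier_vec (k + 1) \<Longrightarrow>
      weighted_inner M (?U *\<^sub>v z) (?U *\<^sub>v ?c) = of_real \<mu> * cnj (z $ k)"
    using MPE_c_characterisation[OF k rank] by blast
  have Uc: "?U *\<^sub>v z \<in> carrier_vec N" if "z \<in> carrier_vec (k + 1)" for z
    using diff_mat_carrier[of k] that by simp
  have "of_real \<tau> * (\<Sum>i = 0..k. ?c $ i) = cnj (weighted_inner M (?U *\<^sub>v ?c) (?U *\<^sub>v ?\<gamma>))"
    using RRE[OF c] by simp
  also have "\<dots> = weighted_inner M (?U *\<^sub>v ?\<gamma>) (?U *\<^sub>v ?c)"
    using weighted_inner_swap[OF Uc[OF \<gamma>] Uc[OF c]] by simp
  also have "\<dots> = of_real \<mu> * cnj (?\<gamma> $ k)"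
    using MPE[OF \<gamma>] .
  finally have "of_real \<tau> * (\<Sum>i = 0..k. ?c $ i) = of_real \<mu> * cnj (?\<gamma> $ k)" .
  then show ?thesis
    using \<tau> \<mu> by (metis complex_cnj_zero_iff mult_eq_0_iff of_real_eq_0_iff less_irrefl)
qed

text \<open>The RRE problem of order \<open>k - 1\<close> is the one of order \<open>k\<close> restricted to coefficient vectors with last
  entry 0. A minimiser of the larger problem that lies in the restricted feasible set is also the
  minimiser there.\<close>

lemma RRE_gamma_eq_snoc_if_last_zero:
  assumes k: "1 \<le> k"
    and rank: "vec_space.rank N (diff_mat N x k) = k + 1"
    and rank': "vec_space.rank N (diff_mat N x (k - 1)) = k"
    and last: "RRE_gamma N M x k $ k = 0"
  shows "RRE_gamma N M x k = snoc_vec (RRE_gamma N M x (k - 1)) 0"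
proof -
  let ?\<gamma> = "RRE_gamma N M x k" and ?\<gamma>' = "RRE_gamma N M x (k - 1)"
  have Suc: "k - 1 + 1 = k" using k by simp
  obtain \<gamma>: "?\<gamma> \<in> carrier_vec (k + 1)" "(\<Sum>i = 0..k. ?\<gamma> $ i) = 1"
    and min: "\<And>z. is_arg_min (\<lambda>z. weighted_norm M (diff_mat N x k *\<^sub>v z))
      (\<lambda>z. z \<in> carrier_vec (k + 1) \<and> (\<Sum>i = 0..k. z $ i) = 1) z \<longleftrightarrow> z = ?\<gamma>"
    using RRE_gamma_characterisation[OF rank] by blast
  obtain \<gamma>': "?\<gamma>' \<in> carrier_vec k" "(\<Sum>i = 0..k - 1. ?\<gamma>' $ i) = 1"
    and min': "\<And>z. is_arg_min (\<lambda>z. weighted_norm M (diff_mat N x (k - 1) *\<^sub>v z))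
      (\<lambda>z. z \<in> carrier_vec k \<and> (\<Sum>i = 0..k - 1. z $ i) = 1) z \<longleftrightarrow> z = ?\<gamma>'"
    using RRE_gamma_characterisation[of "k - 1", unfolded Suc, OF rank'] by blast
  have mult: "diff_mat N x k *\<^sub>v snoc_vec z 0 = diff_mat N x (k - 1) *\<^sub>v z"
    if "z \<in> carrier_vec k" for z
    by (rule diff_mat_snoc_zero[OF that k])
  obtain w where w: "w \<in> carrier_vec k" and \<gamma>w: "?\<gamma> = snoc_vec w 0"
    using snoc_vec_surj[OF \<gamma>(1)] last by metis
  have "is_arg_min (\<lambda>z. weighted_norm M (diff_mat N x (k - 1) *\<^sub>v z))
      (\<lambda>z. z \<in> carrier_vec k \<and> (\<Sum>i = 0..k - 1. z $ i) = 1) w"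
    unfolding is_arg_min_def
  proof (intro conjI notI)
    show "w \<in> carrier_vec k" by (rule w)
    show "(\<Sum>i = 0..k - 1. w $ i) = 1"
      using \<gamma>(2) sum_snoc_vec[OF w k, of 0] by (simp add: \<gamma>w)
    assume "\<exists>y. (y \<in> carrier_vec k \<and> (\<Sum>i = 0..k - 1. y $ i) = 1) \<and>
      weighted_norm M (diff_mat N x (k - 1) *\<^sub>v y) < weighted_norm M (diff_mat N x (k - 1) *\<^sub>v w)"
    then obtain y where y: "y \<in> carrier_vec k" "(\<Sum>i = 0..k - 1. y $ i) = 1"
      "weighted_norm M (diff_mat N x k *\<^sub>v snoc_vec y 0) < weighted_norm M (diff_mat N x k *\<^sub>v ?\<gamma>)"
      using mult w \<gamma>w by auto
    then show False
      using min[of ?\<gamma>] snoc_vec_carrier[OF y(1), of 0] sum_snoc_vec[OF y(1) k, of 0]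
      by (auto simp: is_arg_min_def)
  qed
  then show ?thesis using min' \<gamma>w by simp
qed

end

theorem theorem1:
  fixes N k k0 :: nat and M :: "complex mat" and x :: "nat \<Rightarrow> complex vec"
  assumes "hermitian_pos_def N M"
    and "\<And>m. x m \<in> carrier_vec N"
    and "rank_index N x k0"
    and "1 \<le> k" and "k < k0"
  shows "(s_MPE N M x k = None \<longrightarrow>
            s_RRE N M x k = s_RRE N M x (k - 1) \<and>
            diff_mat N x k *\<^sub>v RRE_gamma N M x k =
              diff_mat N x (k - 1) *\<^sub>v RRE_gamma N M x (k - 1)) \<and>
         (s_RRE N M x k = s_RRE N M x (k - 1) \<longrightarrow> s_MPE N M x k = None)"
proof -
  note k = assms(4)
  interpret vector_sequence N M x
    by unfold_locales (use assms(1,2) in auto)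
  let ?\<gamma> = "RRE_gamma N M x k" and ?\<gamma>' = "RRE_gamma N M x (k - 1)"
  have Suc: "k - 1 + 1 = k" using k by simp
  have rank: "vec_space.rank N (diff_mat N x k) = k + 1"
    and rank': "vec_space.rank N (diff_mat N x (k - 1)) = k"
    using assms(3-5) by (auto simp: rank_index_def)
  obtain \<gamma>: "?\<gamma> \<in> carrier_vec (k + 1)" "(\<Sum>i = 0..k. ?\<gamma> $ i) = 1"
    using RRE_gamma_characterisation[OF rank] by blast
  obtain \<gamma>': "?\<gamma>' \<in> carrier_vec k" "(\<Sum>i = 0..k - 1. ?\<gamma>' $ i) = 1"
    using RRE_gamma_characterisation[of "k - 1", unfolded Suc, OF rank'] by blast
  have breakdown: "s_MPE N M x k = None \<longleftrightarrow> ?\<gamma> $ k = 0"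
    using MPE_sum_zero_iff[OF k rank] by (simp add: s_MPE_def)
  show ?thesis
  proof (intro conjI impI)
    assume "s_MPE N M x k = None"
    then have eq: "?\<gamma> = snoc_vec ?\<gamma>' 0"
      using breakdown RRE_gamma_eq_snoc_if_last_zero[OF k rank rank'] by blast
    show "s_RRE N M x k = s_RRE N M x (k - 1)"
      using extrapolate_snoc_zero[OF \<gamma>'(1) k] by (simp add: s_RRE_def eq)
    show "diff_mat N x k *\<^sub>v ?\<gamma> = diff_mat N x (k - 1) *\<^sub>v ?\<gamma>'"
      using diff_mat_snoc_zero[OF \<gamma>'(1) k] by (simp add: eq)
  next
    assume "s_RRE N M x k = s_RRE N M x (k - 1)"
    then show "s_MPE N M x k = None"
      using extrapolate_eq_imp_last_zero[OF k rank' \<gamma> \<gamma>'] breakdown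
      by (simp add: s_RRE_def)
  qed
qed

end
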